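(* Let $m\le n$ be positive integers. If $\mathcal{S}\subseteq\mathbb{S}$ satisfies $D_{m,m}=0$ for all $D=(D_{i,j})_{n\times m}\in\mathcal{S}$, then $\mu(\mathcal{S})=0$ (in particular the limit defining it exists); in other words, the probability that an $n\times m$ matrix with independent entries uniform on $\mathbb{Z}_{(k)}$ is of full rank goes to $1$ as $k\to\infty$.
   Context: For a positive integer $k$, $\mathbb{Z}_{(k)}=\{-k,\dots,k\}$. The Smith normal form (SNF) of an $n\times m$ integer matrix $M$ is the diagonal matrix $PMQ$ ($P,Q$ invertible over $\mathbb{Z}$) with nonnegative diagonal entries $d_1\mid d_2\mid\cdots\mid d_m$ (trailing entries may be $0$); the SNF of the zero matrix is itself. $\mathbb{S}$ is the set of $n\times m$ diagonal integer matrices whose diagonal entries $(d_1,\dots,d_m)$ are nonnegative with $d_{i+1}$ a multiple of $d_i$ for $1\le i\le m-1$. For $\mathcal{S}\subseteq\mathbb{S}$, $\mu^{(k)}(\mathcal{S})$ is the probability that $\mathrm{SNF}(M)\in\mathcal{S}$ for a random $n\times m$ matrix $M$ with independent entries uniform on $\mathbb{Z}_{(k)}$, and $\mu(\mathcal{S})=\lim_{k\to\infty}\mu^{(k)}(\mathcal{S})$ if the limit exists. *)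

theory Defs
  imports "HOL-Probability.Probability" "HOL-Probability.Product_PMF"
    "Jordan_Normal_Form.Matrix" "Jordan_Normal_Form.DL_Rank"
begin

text \<open>Matrix indices start at 0, so the entry in row \<open>m\<close>, column \<open>m\<close> of the usual notation is
  \<open>D $$ (m - 1, m - 1)\<close>. Throughout, \<open>m \<le> n\<close>, so that an \<open>n \<times> m\<close> matrix has \<open>m\<close> diagonal entries.\<close>

definition SNF_set :: "nat \<Rightarrow> nat \<Rightarrow> int mat set" where
  "SNF_set n m = {D \<in> carrier_mat n m. diagonal_mat D \<and>
     (\<forall>i<m. 0 \<le> D $$ (i, i)) \<and>
     (\<forall>i. Suc i < m \<longrightarrow> D $$ (i, i) dvd D $$ (Suc i, Suc i))}"

definition SNF :: "int mat \<Rightarrow> int mat" where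
  "SNF M = (THE D. D \<in> SNF_set (dim_row M) (dim_col M) \<and>
     (\<exists>P Q. P \<in> carrier_mat (dim_row M) (dim_row M) \<and> invertible_mat P \<and>
            Q \<in> carrier_mat (dim_col M) (dim_col M) \<and> invertible_mat Q \<and>
            D = P * M * Q))"

text \<open>The entries form a product distribution, i.e. they are independent, each uniform on
  \<open>{-k..k}\<close>. The second argument of \<open>Pi_pmf\<close> is only the value outside the index range.\<close>

definition random_int_mat :: "nat \<Rightarrow> nat \<Rightarrow> nat \<Rightarrow> int mat pmf" where
  "random_int_mat k n m =
     map_pmf (mat n m) (Pi_pmf ({..<n} \<times> {..<m}) 0 (\<lambda>_. pmf_of_set {- int k..int k}))"

definition mu_k :: "nat \<Rightarrow> nat \<Rightarrow> nat \<Rightarrow> int mat set \<Rightarrow> real" where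
  "mu_k k n m S = measure_pmf.prob (random_int_mat k n m) {M. SNF M \<in> S}"

text \<open>Meaningful only if the sequence converges; this has to be asserted separately.\<close>

definition mu :: "nat \<Rightarrow> nat \<Rightarrow> int mat set \<Rightarrow> real" where
  "mu n m S = lim (\<lambda>k. mu_k k n m S)"

end

theory Submission
  imports Defs "Jordan_Normal_Form.DL_Rank_Submatrix"
begin

text \<open>
  An \<open>n \<times> m\<close> matrix whose leading \<open>m \<times> m\<close> minor does not vanish has full rank, and its Smith
  normal form \<open>D\<close> has no zero on the diagonal: if the last column of \<open>D = P * M * Q\<close> were zero, then
  the last column of \<open>Q\<close> would be a nonzero vector in the kernel of \<open>M\<close>. So both claims follow once
  the leading minor of a random matrix vanishes with probability tending to 0.

  For this let \<open>\<Delta> t\<close> be the leading \<open>t \<times> t\<close> minor. Laplace expansion along the last row shows that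
  \<open>\<Delta> (t + 1)\<close> is an affine function of the entry in position \<open>(t, t)\<close>, with slope \<open>\<Delta> t\<close>, and
  \<open>\<Delta> t\<close> does not depend on that entry. Hence, for all other entries fixed with \<open>\<Delta> t \<noteq> 0\<close>, at most
  one of the \<open>2 * k + 1\<close> values of the entry makes \<open>\<Delta> (t + 1)\<close> vanish. By induction
  \<open>\<Delta> m = 0\<close> has probability at most \<open>m / (2 * k + 1)\<close> (\<open>prob_leading_minor_zero\<close>).

  Since \<open>SNF\<close> is a definite description, anything said about its value rests on the existence
  (\<open>SNF_exists\<close>) and uniqueness (\<open>SNF_unique\<close>) of the Smith normal form over the integers.
  Existence is an induction that splits off a smallest positive corner entry among all equivalent
  matrices; minimality makes it divide everything else. Uniqueness is usually derived from the
  gcds of minors and the Cauchy--Binet formula. The argument here is shorter: two Smith forms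
  satisfy \<open>D' * R = P * D\<close> with \<open>P\<close>, \<open>R\<close> unimodular, so \<open>D' $$ (i, i)\<close> divides
  \<open>P $$ (a, b) * D $$ (i, i)\<close> for all \<open>a \<ge> i \<ge> b\<close>. Each term of the Leibniz formula for \<open>det P\<close>
  contains an entry of this block, so \<open>D' $$ (i, i)\<close> divides \<open>det P * D $$ (i, i)\<close>, that is, it
  divides \<open>D $$ (i, i)\<close>.
\<close>

section \<open>Unimodular equivalence\<close>

lemma index_mult_mat_sum:
  assumes "A \<in> carrier_mat n l" "B \<in> carrier_mat l m" "i < n" "j < m"
  shows "(A * B) $$ (i, j) = (\<Sum>k = 0..<l. A $$ (i, k) * B $$ (k, j))"
  using assms by (auto simp: scalar_prod_def)

text \<open>
  Invertibility over the integers is expressed by the determinant, because it is then inherited at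
  once by products, elementary matrices and block diagonal matrices.
\<close>

definition unimodular :: "nat \<Rightarrow> int mat \<Rightarrow> bool" where
  "unimodular n P \<longleftrightarrow> P \<in> carrier_mat n n \<and> det P dvd 1"

lemma unimodular_carrier: "unimodular n P \<Longrightarrow> P \<in> carrier_mat n n"
  by (simp add: unimodular_def)

lemma unimodular_one: "unimodular n (1\<^sub>m n)"
  by (simp add: unimodular_def)

lemma unimodular_mult: "unimodular n P \<Longrightarrow> unimodular n Q \<Longrightarrow> unimodular n (P * Q)"
  unfolding unimodular_def using det_mult[of P n Q] is_unit_mult_iff by (metis mult_carrier_mat)

lemma unimodular_inverse:
  assumes "unimodular n P"
  obtains R where "unimodular n R" "P * R = 1\<^sub>m n" "R * P = 1\<^sub>m n"
proof
  have P: "P \<in> carrier_mat n n" and d: "det P dvd 1" using assms by (auto simp: unimodular_def)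
  let ?R = "det P \<cdot>\<^sub>m adj_mat P"
  \<comment> \<open>The determinant is \<open>1\<close> or \<open>-1\<close>, hence its own inverse.\<close>
  have dd: "det P * det P = 1" using d by (auto simp: zdvd1_eq abs_if split: if_splits)
  have R: "?R \<in> carrier_mat n n" using adj_mat(1)[OF P] by simp
  show PR: "P * ?R = 1\<^sub>m n"
    using mult_smult_distrib[OF P adj_mat(1)[OF P], of "det P"] adj_mat(2)[OF P] dd
    by (auto intro!: eq_matI)
  show "?R * P = 1\<^sub>m n"
    using mult_smult_assoc_mat[OF adj_mat(1)[OF P] P, of "det P"] adj_mat(3)[OF P] dd
    by (auto intro!: eq_matI)
  have "det P * det ?R = 1" using det_mult[OF P R] PR by simp
  then have "det ?R dvd 1" by (metis dvd_triv_right)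
  then show "unimodular n ?R" using R by (simp add: unimodular_def)
qed

lemma unimodular_iff_invertible:
  "unimodular n P \<longleftrightarrow> P \<in> carrier_mat n n \<and> invertible_mat P"
proof
  assume U: "unimodular n P"
  then obtain R where "unimodular n R" "P * R = 1\<^sub>m n" "R * P = 1\<^sub>m n"
    by (rule unimodular_inverse)
  then show "P \<in> carrier_mat n n \<and> invertible_mat P"
    using U by (auto simp: invertible_mat_def inverts_mat_def unimodular_def)
next
  assume A: "P \<in> carrier_mat n n \<and> invertible_mat P"
  then have P: "P \<in> carrier_mat n n" by simp
  from A obtain R where PR: "P * R = 1\<^sub>m n" and RP: "R * P = 1\<^sub>m (dim_row R)"
    by (auto simp: invertible_mat_def inverts_mat_def)
  have R: "R \<in> carrier_mat n n"
    using arg_cong[OF PR, of dim_col] arg_cong[OF RP, of dim_col] P by auto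
  have "det P * det R = 1" using det_mult[OF P R] PR by simp
  then have "det P dvd 1" by (metis dvd_triv_left)
  then show "unimodular n P" using P by (simp add: unimodular_def)
qed

definition unimod_equiv :: "nat \<Rightarrow> nat \<Rightarrow> int mat \<Rightarrow> int mat \<Rightarrow> bool" where
  "unimod_equiv n m A B \<longleftrightarrow> A \<in> carrier_mat n m \<and>
     (\<exists>P Q. unimodular n P \<and> unimodular m Q \<and> B = P * A * Q)"

lemma unimod_equiv_carrier:
  "unimod_equiv n m A B \<Longrightarrow> A \<in> carrier_mat n m"
  "unimod_equiv n m A B \<Longrightarrow> B \<in> carrier_mat n m"
  by (auto simp: unimod_equiv_def unimodular_def)

lemma unimod_equiv_refl: "A \<in> carrier_mat n m \<Longrightarrow> unimod_equiv n m A A"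
  unfolding unimod_equiv_def
  using unimodular_one by (metis left_mult_one_mat right_mult_one_mat)

lemma unimod_equiv_trans:
  assumes "unimod_equiv n m A B" "unimod_equiv n m B C"
  shows "unimod_equiv n m A C"
proof -
  obtain P Q P' Q' where A: "A \<in> carrier_mat n m"
    and U: "unimodular n P" "unimodular m Q" "unimodular n P'" "unimodular m Q'"
    and eq: "B = P * A * Q" "C = P' * B * Q'"
    using assms by (auto simp: unimod_equiv_def)
  note c = U[THEN unimodular_carrier]
  have "P' * (P * A * Q) = P' * P * A * Q"
    using c A by (simp add: assoc_mult_mat[of _ n n _ n _ m] assoc_mult_mat[of _ n n _ m _ m])
  then have "C = (P' * P) * A * (Q * Q')"
    using c A unfolding eq by (simp add: assoc_mult_mat[of _ n m _ m _ m])
  then show ?thesis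
    unfolding unimod_equiv_def
    using A unimodular_mult[OF U(3,1)] unimodular_mult[OF U(2,4)] by blast
qed

lemma unimod_equiv_sym:
  assumes "unimod_equiv n m A B"
  shows "unimod_equiv n m B A"
proof -
  obtain P Q where A: "A \<in> carrier_mat n m" and U: "unimodular n P" "unimodular m Q"
    and eq: "B = P * A * Q"
    using assms by (auto simp: unimod_equiv_def)
  obtain R where R: "unimodular n R" "R * P = 1\<^sub>m n" using unimodular_inverse[OF U(1)] by metis
  obtain S where S: "unimodular m S" "Q * S = 1\<^sub>m m" using unimodular_inverse[OF U(2)] by metis
  note c = U[THEN unimodular_carrier] R(1)[THEN unimodular_carrier] S(1)[THEN unimodular_carrier]
  have "R * (P * A * Q) = R * P * A * Q"
    using c A by (simp add: assoc_mult_mat[of _ n n _ n _ m] assoc_mult_mat[of _ n n _ m _ m])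
  then have "R * B * S = A * (Q * S)"
    using c A unfolding eq R(2) by (simp add: assoc_mult_mat[of _ n m _ m _ m])
  then have "A = R * B * S" using A S(2) by simp
  then show ?thesis using R(1) S(1) unimod_equiv_carrier(2)[OF assms]
    by (auto simp: unimod_equiv_def)
qed

lemma unimod_equiv_left:
  "A \<in> carrier_mat n m \<Longrightarrow> unimodular n P \<Longrightarrow> unimod_equiv n m A (P * A)"
  unfolding unimod_equiv_def using unimodular_one
  by (metis mult_carrier_mat right_mult_one_mat unimodular_carrier)

lemma unimod_equiv_right:
  "A \<in> carrier_mat n m \<Longrightarrow> unimodular m Q \<Longrightarrow> unimod_equiv n m A (A * Q)"
  unfolding unimod_equiv_def using unimodular_one
  by (metis left_mult_one_mat)

lemma unimod_equiv_addrow: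
  assumes "A \<in> carrier_mat n m" "k \<noteq> l" "l < n"
  shows "unimod_equiv n m A (addrow a k l A)"
  unfolding addrow_mat[OF assms(1,3)]
  by (rule unimod_equiv_left[OF assms(1)]) (simp add: unimodular_def det_addrow_mat[OF assms(2)])

lemma unimod_equiv_addcol:
  assumes "A \<in> carrier_mat n m" "k \<noteq> l" "l < m"
  shows "unimod_equiv n m A (addcol a k l A)"
  unfolding addcol_mat[OF assms(1,3)]
  by (rule unimod_equiv_right[OF assms(1)])
     (simp add: unimodular_def det_addrow_mat[OF assms(2)[symmetric]])

lemma unimod_equiv_swaprows:
  assumes "A \<in> carrier_mat n m" "k < n" "l < n"
  shows "unimod_equiv n m A (swaprows k l A)"
proof (cases "k = l")
  case True
  have "swaprows k l A = A" using True by (intro eq_matI) auto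
  then show ?thesis using unimod_equiv_refl assms(1) by simp
next
  case False
  show ?thesis unfolding swaprows_mat[OF assms]
    by (rule unimod_equiv_left[OF assms(1)])
       (simp add: unimodular_def det_swaprows_mat[OF assms(2,3) False])
qed

lemma unimod_equiv_swapcols:
  assumes "A \<in> carrier_mat n m" "k < m" "l < m"
  shows "unimod_equiv n m A (swapcols k l A)"
proof (cases "k = l")
  case True
  have "swapcols k l A = A" using True by (intro eq_matI) auto
  then show ?thesis using unimod_equiv_refl assms(1) by simp
next
  case False
  show ?thesis unfolding swapcols_mat[OF assms]
    by (rule unimod_equiv_right[OF assms(1)])
       (simp add: unimodular_def det_swaprows_mat[OF assms(2,3) False])
qed

lemma unimod_equiv_negate_row:
  assumes "A \<in> carrier_mat n m" "k < n"
  shows "unimod_equiv n m A (multrow k (-1) A)"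
  unfolding multrow_mat[OF assms(1)]
  by (rule unimod_equiv_left[OF assms(1)]) (simp add: unimodular_def det_multrow_mat[OF assms(2)])

section \<open>Existence of the Smith normal form\<close>

text \<open>
  Every nonzero entry gives a positive corner entry of the same size, so minimality of a positive
  corner within an equivalence class is minimality among all nonzero entries of the class.
\<close>
lemma unimod_equiv_corner:
  assumes A: "A \<in> carrier_mat n m" and ij: "i < n" "j < m"
  shows "\<exists>B. unimod_equiv n m A B \<and> B $$ (0, 0) = \<bar>A $$ (i, j)\<bar>"
proof -
  let ?B = "swapcols 0 j (swaprows 0 i A)"
  have c: "swaprows 0 i A \<in> carrier_mat n m" "?B \<in> carrier_mat n m"
    using A by auto
  have B: "unimod_equiv n m A ?B"
    using unimod_equiv_trans[OF unimod_equiv_swaprows[OF A _ ij(1), of 0]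
        unimod_equiv_swapcols[OF c(1) _ ij(2), of 0]] ij by auto
  have e: "?B $$ (0, 0) = A $$ (i, j)" using A ij by auto
  show ?thesis
  proof (cases "A $$ (i, j) \<ge> 0")
    case True
    then show ?thesis using B e by auto
  next
    case False
    have "unimod_equiv n m A (multrow 0 (-1) ?B)"
      using unimod_equiv_trans[OF B unimod_equiv_negate_row[OF c(2)]] ij by auto
    moreover have "multrow 0 (-1) ?B $$ (0, 0) = \<bar>A $$ (i, j)\<bar>"
      using e False c(2) ij by (subst index_mat_multrow) auto
    ultimately show ?thesis by blast
  qed
qed

text \<open>
  One division step by the corner leaves a remainder smaller than \<open>d\<close>, which minimality forces to
  be zero.
\<close>
lemma minimal_corner_dvd:
  assumes A: "A \<in> carrier_mat n m" and pos: "0 < n" "0 < m" and d: "A $$ (0, 0) = d" "0 < d"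
    and min: "\<And>B i j. unimod_equiv n m A B \<Longrightarrow> i < n \<Longrightarrow> j < m \<Longrightarrow> B $$ (i, j) \<noteq> 0 \<Longrightarrow>
                d \<le> \<bar>B $$ (i, j)\<bar>"
  shows "i < n \<Longrightarrow> d dvd A $$ (i, 0)" and "j < m \<Longrightarrow> d dvd A $$ (0, j)"
proof -
  assume i: "i < n"
  show "d dvd A $$ (i, 0)"
  proof (cases "i = 0")
    case False
    let ?B = "addrow (- (A $$ (i, 0) div d)) i 0 A"
    have e: "?B $$ (i, 0) = A $$ (i, 0) mod d"
      using A i pos d by (simp add: minus_div_mult_eq_mod [symmetric])
    have "\<bar>A $$ (i, 0) mod d\<bar> < d" using d by simp
    then have "?B $$ (i, 0) = 0"
      using min[OF unimod_equiv_addrow[OF A False pos(1), of "- (A $$ (i, 0) div d)"] i pos(2)] e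
      by linarith
    then show ?thesis using e by auto
  qed (use d in simp)
next
  assume j: "j < m"
  show "d dvd A $$ (0, j)"
  proof (cases "j = 0")
    case False
    let ?B = "addcol (- (A $$ (0, j) div d)) j 0 A"
    have e: "?B $$ (0, j) = A $$ (0, j) mod d"
      using A j pos d by (simp add: minus_div_mult_eq_mod [symmetric])
    have "\<bar>A $$ (0, j) mod d\<bar> < d" using d by simp
    then have "?B $$ (0, j) = 0"
      using min[OF unimod_equiv_addcol[OF A False pos(2), of "- (A $$ (0, j) div d)"] pos(1) j] e
      by linarith
    then show ?thesis using e by auto
  qed (use d in simp)
qed

definition border :: "nat \<Rightarrow> nat \<Rightarrow> int \<Rightarrow> int mat \<Rightarrow> int mat" where
  "border n m d X = four_block_mat (d \<cdot>\<^sub>m 1\<^sub>m 1) (0\<^sub>m 1 m) (0\<^sub>m n 1) X"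

lemma border_carrier: "X \<in> carrier_mat n m \<Longrightarrow> border n m d X \<in> carrier_mat (Suc n) (Suc m)"
  unfolding border_def using four_block_carrier_mat[of "d \<cdot>\<^sub>m 1\<^sub>m 1" 1 1 X n m] by simp

lemma border_index:
  assumes "X \<in> carrier_mat n m" "i < Suc n" "j < Suc m"
  shows "border n m d X $$ (i, j) =
    (if i = 0 then if j = 0 then d else 0 else if j = 0 then 0 else X $$ (i - 1, j - 1))"
  using assms unfolding border_def by auto

lemma border_mult:
  assumes "X \<in> carrier_mat n l" "Y \<in> carrier_mat l m"
  shows "border n l a X * border l m b Y = border n m (a * b) (X * Y)"
  unfolding border_def
  by (subst mult_four_block_mat[of _ 1 1 _ l _ n _ _ 1 _ m]) (use assms in auto)

lemma unimodular_border:
  assumes "unimodular n P"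
  shows "unimodular (Suc n) (border n n 1 P)"
proof -
  have P: "P \<in> carrier_mat n n" using assms by (rule unimodular_carrier)
  have "det (border n n 1 P) = det P"
    unfolding border_def by (subst det_four_block_mat_upper_right_zero[of _ 1 _ n]) (use P in auto)
  then show ?thesis using assms border_carrier[OF P] by (simp add: unimodular_def)
qed

lemma unimod_equiv_border:
  assumes "unimod_equiv n m X Y"
  shows "unimod_equiv (Suc n) (Suc m) (border n m d X) (border n m d Y)"
proof -
  obtain P Q where X: "X \<in> carrier_mat n m" and U: "unimodular n P" "unimodular m Q"
    and eq: "Y = P * X * Q"
    using assms by (auto simp: unimod_equiv_def)
  note c = U[THEN unimodular_carrier]
  have "border n m d Y = border n n 1 P * border n m d X * border m m 1 Q"
    using c X unfolding eq by (simp add: border_mult[of _ _ n] border_mult[of _ _ m])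
  then show ?thesis using border_carrier[OF X] U[THEN unimodular_border]
    by (auto simp: unimod_equiv_def)
qed

text \<open>
  Clearing the first row and column at once, by the Schur complement: with \<open>1 \<times> 1\<close> corner \<open>d\<close>,
  first row \<open>d * r\<close> and first column \<open>d * c\<close>, the matrix is the product of a unimodular lower
  triangular matrix (from \<open>c\<close>), the bordered matrix, and a unimodular upper triangular matrix
  (from \<open>r\<close>).
\<close>
lemma unimod_equiv_clear:
  assumes A: "A \<in> carrier_mat (Suc n) (Suc m)" and d: "A $$ (0, 0) = d"
    and dvd: "\<And>i. i < Suc n \<Longrightarrow> d dvd A $$ (i, 0)" "\<And>j. j < Suc m \<Longrightarrow> d dvd A $$ (0, j)"
  shows "\<exists>X \<in> carrier_mat n m. unimod_equiv (Suc n) (Suc m) A (border n m d X)"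
proof -
  define r where "r = mat 1 m (\<lambda>(i, j). A $$ (0, Suc j) div d)"
  define c where "c = mat n 1 (\<lambda>(i, j). A $$ (Suc i, 0) div d)"
  define X where "X = mat n m (\<lambda>(i, j). A $$ (Suc i, Suc j) - d * (c $$ (i, 0) * r $$ (0, j)))"
  define P where "P = four_block_mat (1\<^sub>m 1) (0\<^sub>m 1 n) c (1\<^sub>m n)"
  define Q where "Q = four_block_mat (1\<^sub>m 1) r (0\<^sub>m m 1) (1\<^sub>m m)"
  have cr: "c \<in> carrier_mat n 1" "r \<in> carrier_mat 1 m" "X \<in> carrier_mat n m"
    by (auto simp: c_def r_def X_def)
  have P: "unimodular (Suc n) P"
    unfolding unimodular_def P_def using cr
    by (subst det_four_block_mat_upper_right_zero[of _ 1 _ n])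
       (auto intro!: four_block_carrier_mat[of _ 1 1 _ n n, simplified])
  have Q: "unimodular (Suc m) Q"
    unfolding unimodular_def Q_def using cr
    by (subst det_four_block_mat_lower_left_zero[of _ 1 _ m])
       (auto intro!: four_block_carrier_mat[of _ 1 1 _ m m, simplified])
  have PB: "P * border n m d X = four_block_mat (d \<cdot>\<^sub>m 1\<^sub>m 1) (0\<^sub>m 1 m) (d \<cdot>\<^sub>m c) X"
    unfolding P_def border_def using cr
    by (subst mult_four_block_mat[of _ 1 1 _ n _ n _ _ 1 _ m])
       (auto simp: mult_smult_distrib[of _ n 1 _ 1])
  have "P * border n m d X * Q = four_block_mat (d \<cdot>\<^sub>m 1\<^sub>m 1) (d \<cdot>\<^sub>m r) (d \<cdot>\<^sub>m c) (d \<cdot>\<^sub>m (c * r) + X)"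
    unfolding PB unfolding Q_def using cr
    by (subst mult_four_block_mat[of _ 1 1 _ m _ n _ _ 1 _ m])
       (auto simp: mult_smult_assoc_mat[of _ 1 1 _ m] mult_smult_assoc_mat[of _ n 1 _ m])
  also have "\<dots> = A"
  proof (rule eq_matI)
    fix i j assume "i < dim_row A" "j < dim_col A"
    then have ij: "i < Suc n" "j < Suc m" using A by auto
    show "four_block_mat (d \<cdot>\<^sub>m 1\<^sub>m 1) (d \<cdot>\<^sub>m r) (d \<cdot>\<^sub>m c) (d \<cdot>\<^sub>m (c * r) + X) $$ (i, j) = A $$ (i, j)"
      using ij cr d dvd(1)[of i] dvd(2)[of j]
      by (cases i; cases j) (auto simp: c_def r_def X_def scalar_prod_def)
  qed (use A cr in auto)
  finally have "unimod_equiv (Suc n) (Suc m) (border n m d X) A"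
    using P Q border_carrier[OF cr(3)] by (auto simp: unimod_equiv_def)
  then show ?thesis using unimod_equiv_sym cr(3) by blast
qed

lemma dvd_unimod_equiv:
  assumes "unimod_equiv n m X Y" and dvd: "\<And>i j. i < n \<Longrightarrow> j < m \<Longrightarrow> d dvd X $$ (i, j)"
    and ij: "i < n" "j < m"
  shows "d dvd Y $$ (i, j)"
proof -
  obtain P Q where X: "X \<in> carrier_mat n m" and c: "P \<in> carrier_mat n n" "Q \<in> carrier_mat m m"
    and eq: "Y = P * X * Q"
    using assms(1) by (auto simp: unimod_equiv_def unimodular_def)
  have PX: "P * X \<in> carrier_mat n m" using c X by simp
  have 1: "d dvd (P * X) $$ (i, j)" if "i < n" "j < m" for i j
    using that X c dvd by (auto simp: scalar_prod_def intro!: dvd_sum)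
  have "Y $$ (i, j) = (\<Sum>l = 0..<m. (P * X) $$ (i, l) * Q $$ (l, j))"
    unfolding eq using ij by (intro index_mult_mat_sum[OF PX c(2)])
  then show ?thesis using 1 ij by (auto intro!: dvd_sum simp del: index_mult_mat(1))
qed

theorem SNF_exists:
  "M \<in> carrier_mat n m \<Longrightarrow> m \<le> n \<Longrightarrow> \<exists>D \<in> SNF_set n m. unimod_equiv n m M D"
proof (induction m arbitrary: n M)
  case 0
  then have "M \<in> SNF_set n 0" by (auto simp: SNF_set_def diagonal_mat_def)
  then show ?case using unimod_equiv_refl 0 by blast
next
  case (Suc m n' M)
  then obtain n where n: "n' = Suc n" and mn: "m \<le> n" by (cases n') auto
  note M = Suc.prems(1)[unfolded n]
  let ?E = "unimod_equiv (Suc n) (Suc m)"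
  show ?case unfolding n
  proof (cases "\<exists>i j. i < Suc n \<and> j < Suc m \<and> M $$ (i, j) \<noteq> 0")
    case False
    then have "M \<in> SNF_set (Suc n) (Suc m)"
      using M mn by (auto simp: SNF_set_def diagonal_mat_def)
    then show "\<exists>D \<in> SNF_set (Suc n) (Suc m). ?E M D" using unimod_equiv_refl M by blast
  next
    case True
    then have ex: "\<exists>B. ?E M B \<and> B $$ (0, 0) > 0"
      using unimod_equiv_corner[OF M] by fastforce
    obtain A where A: "?E M A" "A $$ (0, 0) > 0"
      and least: "\<And>B. ?E M B \<Longrightarrow> B $$ (0, 0) > 0 \<Longrightarrow> nat (A $$ (0, 0)) \<le> nat (B $$ (0, 0))"
      using ex_has_least_nat[of "\<lambda>B. ?E M B \<and> B $$ (0, 0) > 0" _ "\<lambda>B. nat (B $$ (0, 0))"] ex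
      by metis
    define d where "d = A $$ (0, 0)"
    have dpos: "d > 0" using A by (simp add: d_def)
    have min: "d \<le> \<bar>B $$ (i, j)\<bar>"
      if B: "?E M B" and ij: "i < Suc n" "j < Suc m" "B $$ (i, j) \<noteq> 0" for B i j
    proof -
      obtain C where C: "?E B C" "C $$ (0, 0) = \<bar>B $$ (i, j)\<bar>"
        using unimod_equiv_corner[OF unimod_equiv_carrier(2)[OF B] ij(1,2)] by blast
      show ?thesis
        using least[OF unimod_equiv_trans[OF B C(1)]] C(2) ij(3) A(2) by (simp add: d_def)
    qed
    have dvd: "i < Suc n \<Longrightarrow> d dvd B $$ (i, 0)" "j < Suc m \<Longrightarrow> d dvd B $$ (0, j)"
      if B: "?E M B" "B $$ (0, 0) = d" for B i j
      using minimal_corner_dvd[OF unimod_equiv_carrier(2)[OF B(1)] _ _ B(2) dpos]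
        min unimod_equiv_trans[OF B(1)] by blast+
    obtain X where X: "X \<in> carrier_mat n m" and AX: "?E A (border n m d X)"
      using unimod_equiv_clear[OF unimod_equiv_carrier(2)[OF A(1)] d_def[symmetric]]
        dvd[OF A(1) d_def[symmetric]] by blast
    note MX = unimod_equiv_trans[OF A(1) AX]
    \<comment> \<open>Adding row \<open>i + 1\<close> to the first row puts the entries of \<open>X\<close> next to the still minimal
      corner \<open>d\<close>.\<close>
    have dX: "d dvd X $$ (i, j)" if ij: "i < n" "j < m" for i j
    proof -
      let ?C = "addrow 1 0 (Suc i) (border n m d X)"
      have "?E M ?C"
        using unimod_equiv_trans[OF MX unimod_equiv_addrow] border_carrier[OF X] ij by simp
      moreover have "?C $$ (0, 0) = d" "?C $$ (0, Suc j) = X $$ (i, j)"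
        using border_carrier[OF X, of d] ij by (auto simp: border_index[OF X])
      ultimately show ?thesis using dvd(2)[of ?C "Suc j"] ij by simp
    qed
    obtain D where D: "D \<in> SNF_set n m" and XD: "unimod_equiv n m X D"
      using Suc.IH[OF X mn] by blast
    have Dc: "D \<in> carrier_mat n m" using D by (simp add: SNF_set_def)
    have dD: "d dvd D $$ (i, j)" if "i < n" "j < m" for i j
      using dvd_unimod_equiv[OF XD dX that] by blast
    have "border n m d D \<in> SNF_set (Suc n) (Suc m)"
      unfolding SNF_set_def mem_Collect_eq
    proof (intro conjI allI impI)
      show "border n m d D \<in> carrier_mat (Suc n) (Suc m)" by (rule border_carrier[OF Dc])
      show "diagonal_mat (border n m d D)"
        using border_carrier[OF Dc, of d] D
        by (auto simp: diagonal_mat_def border_index[OF Dc] SNF_set_def)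
    next
      fix i assume "i < Suc m"
      then show "0 \<le> border n m d D $$ (i, i)"
        using D mn dpos by (auto simp: border_index[OF Dc] SNF_set_def)
    next
      fix i assume i: "Suc i < Suc m"
      show "border n m d D $$ (i, i) dvd border n m d D $$ (Suc i, Suc i)"
        using D mn i dD by (cases i) (auto simp: border_index[OF Dc] SNF_set_def)
    qed
    then show "\<exists>D \<in> SNF_set (Suc n) (Suc m). ?E M D"
      using unimod_equiv_trans[OF MX unimod_equiv_border[OF XD]] by blast
  qed
qed

section \<open>Uniqueness of the Smith normal form\<close>

text \<open>
  A quantitative form of the easy half of the Frobenius--Koenig theorem. The block has \<open>n - i\<close> rows
  and \<open>i + 1\<close> columns, too many for a permutation to avoid it. The factor \<open>y\<close> allows divisibility by
  \<open>x\<close> to be used without cancelling a common factor, and so covers zero diagonal entries as well.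
\<close>
lemma dvd_det_mult:
  fixes P :: "'a :: comm_ring_1 mat"
  assumes P: "P \<in> carrier_mat n n" and i: "i < n"
    and block: "\<And>a b. i \<le> a \<Longrightarrow> a < n \<Longrightarrow> b \<le> i \<Longrightarrow> x dvd P $$ (a, b) * y"
  shows "x dvd det P * y"
  unfolding det_def'[OF P] sum_distrib_right
proof (rule dvd_sum)
  fix p assume "p \<in> {p. p permutes {0..<n}}"
  then have p: "p permutes {0..<n}" by simp
  have "\<exists>a \<in> {i..<n}. p a \<le> i"
  proof (rule ccontr)
    assume "\<not> ?thesis"
    moreover have "p a < n" if "a < n" for a using permutes_in_image[OF p, of a] that by simp
    ultimately have "p ` {i..<n} \<subseteq> {Suc i..<n}" by (auto simp: not_le Suc_le_eq)
    then have "card (p ` {i..<n}) \<le> n - Suc i" using card_mono[of "{Suc i..<n}"] by fastforce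
    moreover have "card (p ` {i..<n}) = n - i"
      using card_image[OF inj_on_subset[OF permutes_inj[OF p]]] by simp
    ultimately show False using i by simp
  qed
  then obtain a where a: "i \<le> a" "a < n" "p a \<le> i" by auto
  have "(\<Prod>a = 0..<n. P $$ (a, p a)) = P $$ (a, p a) * (\<Prod>a \<in> {0..<n} - {a}. P $$ (a, p a))"
    by (rule prod.remove) (use a in auto)
  then have "signof p * (\<Prod>a = 0..<n. P $$ (a, p a)) * y =
      (P $$ (a, p a) * y) * (signof p * (\<Prod>a \<in> {0..<n} - {a}. P $$ (a, p a)))"
    by (simp only: ac_simps)
  then show "x dvd signof p * (\<Prod>a = 0..<n. P $$ (a, p a)) * y"
    using block[OF a] by simp
qed

lemma SNF_set_dvd_mono:
  assumes "D \<in> SNF_set n m" "i \<le> j" "j < m"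
  shows "D $$ (i, i) dvd D $$ (j, j)"
  using assms(2,3)
proof (induction j rule: dec_induct)
  case (step j)
  moreover have "D $$ (j, j) dvd D $$ (Suc j, Suc j)"
    using assms(1) step by (auto simp: SNF_set_def)
  ultimately show ?case by (auto intro: dvd_trans)
qed auto

text \<open>
  In \<open>D' * R = P * D\<close> the left side is divisible by \<open>D' $$ (i, i)\<close> in all rows \<open>a \<ge> i\<close>, as \<open>D'\<close> is a
  divisor chain (rows \<open>a \<ge> m\<close> are zero), and the entries of the right side are
  \<open>P $$ (a, b) * D $$ (b, b)\<close>, where \<open>D $$ (b, b)\<close> divides \<open>D $$ (i, i)\<close> if \<open>b \<le> i\<close>.
\<close>
lemma SNF_diag_dvd:
  assumes D: "D \<in> SNF_set n m" and D': "D' \<in> SNF_set n m" and mn: "m \<le> n"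
    and e: "unimod_equiv n m D D'" and i: "i < m"
  shows "D' $$ (i, i) dvd D $$ (i, i)"
proof -
  have c: "D \<in> carrier_mat n m" "D' \<in> carrier_mat n m" using D D' by (auto simp: SNF_set_def)
  obtain P Q where U: "unimodular n P" "unimodular m Q" and eq: "D' = P * D * Q"
    using e by (auto simp: unimod_equiv_def)
  obtain R where R: "unimodular m R" "Q * R = 1\<^sub>m m" using unimodular_inverse[OF U(2)] by metis
  note cc = U[THEN unimodular_carrier] R(1)[THEN unimodular_carrier]
  have "D' * R = P * D * (Q * R)"
    unfolding eq by (rule assoc_mult_mat[of _ n m _ m _ m]) (use c cc in auto)
  then have DR: "D' * R = P * D" using R(2) c cc by simp
  have "D' $$ (i, i) dvd det P * D $$ (i, i)"
  proof (rule dvd_det_mult)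
    fix a b assume ab: "i \<le> a" "a < n" "b \<le> i"
    then have b: "b < m" using i by simp
    have "(P * D) $$ (a, b) = (\<Sum>l = 0..<n. P $$ (a, l) * D $$ (l, b))"
      by (rule index_mult_mat_sum) (use ab b c cc in auto)
    also have "\<dots> = (\<Sum>l = 0..<n. if l = b then P $$ (a, b) * D $$ (b, b) else 0)"
      using D b by (intro sum.cong) (auto simp: SNF_set_def diagonal_mat_def)
    also have "\<dots> = P $$ (a, b) * D $$ (b, b)" using b mn by simp
    finally have 1: "P $$ (a, b) * D $$ (b, b) = (D' * R) $$ (a, b)" unfolding DR ..
    have "(D' * R) $$ (a, b) = (\<Sum>l = 0..<m. D' $$ (a, l) * R $$ (l, b))"
      by (rule index_mult_mat_sum) (use ab b c cc in auto)
    also have "D' $$ (i, i) dvd \<dots>"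
    proof (rule dvd_sum)
      fix l assume l: "l \<in> {0..<m}"
      show "D' $$ (i, i) dvd D' $$ (a, l) * R $$ (l, b)"
      proof (cases "a = l")
        case True
        then show ?thesis using SNF_set_dvd_mono[OF D', of i a] ab l by auto
      next
        case False
        then show ?thesis using D' ab l by (auto simp: SNF_set_def diagonal_mat_def)
      qed
    qed
    finally have "D' $$ (i, i) dvd P $$ (a, b) * D $$ (b, b)" unfolding 1 .
    moreover have "D $$ (b, b) dvd D $$ (i, i)" using SNF_set_dvd_mono[OF D] ab i by simp
    ultimately show "D' $$ (i, i) dvd P $$ (a, b) * D $$ (i, i)"
      by (meson dvd_trans mult_dvd_mono dvd_refl)
  qed (use cc i mn in auto)
  moreover have "det P dvd 1" using U(1) by (simp add: unimodular_def)
  ultimately show ?thesis by (metis dvd_mult_unit_iff')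
qed

lemma SNF_unique:
  assumes D: "D \<in> SNF_set n m" and D': "D' \<in> SNF_set n m" and mn: "m \<le> n"
    and e: "unimod_equiv n m D D'"
  shows "D = D'"
proof (rule eq_matI)
  have c: "D \<in> carrier_mat n m" "D' \<in> carrier_mat n m" using D D' by (auto simp: SNF_set_def)
  fix i j assume "i < dim_row D'" "j < dim_col D'"
  then have ij: "i < n" "j < m" using c by auto
  show "D $$ (i, j) = D' $$ (i, j)"
  proof (cases "i = j")
    case True
    have "D $$ (j, j) = D' $$ (j, j)"
      using SNF_diag_dvd[OF D D' mn e ij(2)] SNF_diag_dvd[OF D' D mn unimod_equiv_sym[OF e] ij(2)]
        D D' ij by (intro zdvd_antisym_nonneg) (auto simp: SNF_set_def)
    then show ?thesis using True by simp
  next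
    case False
    then show ?thesis using D D' ij by (auto simp: SNF_set_def diagonal_mat_def)
  qed
qed (use D D' in \<open>auto simp: SNF_set_def\<close>)

lemma SNF_correct:
  assumes M: "M \<in> carrier_mat n m" and mn: "m \<le> n"
  shows "SNF M \<in> SNF_set n m" and "unimod_equiv n m M (SNF M)"
proof -
  have eq: "SNF M = (THE D. D \<in> SNF_set n m \<and> unimod_equiv n m M D)"
    using M by (auto simp: SNF_def unimod_equiv_def unimodular_iff_invertible intro!: arg_cong[of _ _ The] ext)
  have "\<exists>!D. D \<in> SNF_set n m \<and> unimod_equiv n m M D"
    using SNF_exists[OF M mn] SNF_unique[OF _ _ mn] unimod_equiv_trans unimod_equiv_sym
    by metis
  from theI'[OF this] show "SNF M \<in> SNF_set n m" and "unimod_equiv n m M (SNF M)"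
    unfolding eq by auto
qed

section \<open>Nonsingular leading minors\<close>

lemma SNF_last_diag_nonzero:
  fixes f :: "nat \<times> nat \<Rightarrow> int"
  assumes m: "0 < m" and mn: "m \<le> n" and det: "det (mat m m f) \<noteq> 0"
  shows "SNF (mat n m f) $$ (m - 1, m - 1) \<noteq> 0"
proof
  let ?M = "mat n m f" and ?D = "SNF (mat n m f)"
  assume z: "?D $$ (m - 1, m - 1) = 0"
  have M: "?M \<in> carrier_mat n m" by simp
  have D: "?D \<in> SNF_set n m" and e: "unimod_equiv n m ?M ?D"
    using SNF_correct[OF M mn] .
  obtain P Q where U: "unimodular n P" "unimodular m Q" and eq: "?M = P * ?D * Q"
    using unimod_equiv_sym[OF e] by (auto simp: unimod_equiv_def)
  obtain R where R: "unimodular m R" "Q * R = 1\<^sub>m m" using unimodular_inverse[OF U(2)] by metis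
  have Dc: "?D \<in> carrier_mat n m" using D by (simp add: SNF_set_def)
  note c = U[THEN unimodular_carrier] R(1)[THEN unimodular_carrier] Dc
  have "?M * R = P * ?D * (Q * R)"
    by (subst eq, rule assoc_mult_mat[of _ n m _ m _ m]) (use c in auto)
  then have MR: "?M * R = P * ?D" using R(2) c by simp
  \<comment> \<open>The kernel vector: \<open>?M\<close> sends it to the last column of \<open>P * ?D\<close>, which is zero.\<close>
  let ?v = "col R (m - 1)"
  have "?D $$ (l, m - 1) = 0" if "l < n" for l
    using D z m that by (cases "l = m - 1") (auto simp: SNF_set_def diagonal_mat_def)
  then have MRz: "(?M * R) $$ (i, m - 1) = 0" if "i < n" for i
    unfolding MR using that m c by (auto simp: scalar_prod_def)
  have "mat m m f *\<^sub>v ?v = 0\<^sub>v m"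
  proof (rule eq_vecI)
    fix i assume "i < dim_vec (0\<^sub>v m :: int vec)"
    then have i: "i < m" by simp
    have "row (mat m m f) i = row ?M i" using i mn by (intro eq_vecI) auto
    then show "(mat m m f *\<^sub>v ?v) $ i = 0\<^sub>v m $ i"
      using MRz[of i] i mn m c by auto
  qed simp
  moreover have "?v \<in> carrier_vec m" using c by auto
  moreover have "?v \<noteq> 0\<^sub>v m"
  proof
    assume v: "?v = 0\<^sub>v m"
    have "(Q * R) $$ (m - 1, m - 1) = row Q (m - 1) \<bullet> ?v" using c m by auto
    also have "\<dots> = 0" unfolding v using c m by auto
    finally show False using R(2) m by simp
  qed
  ultimately show False using det det_0_iff_vec_prod_zero[of "mat m m f" m] by auto
qed

lemma rank_of_leading_minor:
  fixes f :: "nat \<times> nat \<Rightarrow> int"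
  assumes mn: "m \<le> n" and det: "det (mat m m f) \<noteq> 0"
  shows "vec_space.rank n (map_mat rat_of_int (mat n m f)) = m"
proof -
  let ?N = "map_mat rat_of_int (mat n m f)"
  have N: "?N \<in> carrier_mat n m" by simp
  have card: "card {i. i < n \<and> i \<in> {..<m}} = m"
  proof -
    have "{i. i < n \<and> i \<in> {..<m}} = {..<m}" using mn by auto
    then show ?thesis by simp
  qed
  have pick: "pick {..<m} i = i" if "i < m" for i
  proof -
    have "{a \<in> {..<m}. a < i} = {..<i}" using that by auto
    then show ?thesis using pick_card_in_set[of i "{..<m}"] that by simp
  qed
  have "submatrix ?N {..<m} UNIV = map_mat rat_of_int (mat m m f)"
    using mn by (intro eq_matI) (auto simp: submatrix_def card[simplified] pick pick_UNIV)
  then have "det (submatrix ?N {..<m} UNIV) \<noteq> 0"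
    using det by (simp add: of_int_hom.hom_det)
  from vec_space.rank_gt_minor[OF N this] have "m \<le> vec_space.rank n ?N" by simp
  moreover have "vec_space.rank n ?N \<le> m" using vec_space.rank_le_nc[OF N] .
  ultimately show ?thesis by simp
qed

section \<open>Random leading minors\<close>

text \<open>
  Condition on all coordinates but \<open>x\<close>: at most one value of the coordinate \<open>x\<close> remains, and it has
  mass at most \<open>c\<close>.
\<close>
lemma prob_Pi_pmf_one_coordinate:
  assumes A: "finite A" "x \<in> A" and c: "0 \<le> c" "\<And>y. pmf (p x) y \<le> c"
    and E: "\<And>f y z. f(x := y) \<in> E \<Longrightarrow> f(x := z) \<in> E \<Longrightarrow> y = z"
  shows "measure_pmf.prob (Pi_pmf A d p) E \<le> c"
proof -
  let ?F = "Pi_pmf (A - {x}) d p"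
  have "Pi_pmf A d p = Pi_pmf (insert x (A - {x})) d p" using A by (simp add: insert_absorb)
  also have "\<dots> = p x \<bind> (\<lambda>y. ?F \<bind> (\<lambda>f. return_pmf (f(x := y))))"
    using A by (intro Pi_pmf_insert') auto
  also have "\<dots> = ?F \<bind> (\<lambda>f. map_pmf (\<lambda>y. f(x := y)) (p x))"
    by (subst bind_commute_pmf) (simp add: map_pmf_def)
  finally have eq: "Pi_pmf A d p = ?F \<bind> (\<lambda>f. map_pmf (\<lambda>y. f(x := y)) (p x))" .
  have "emeasure (p x) {y. f(x := y) \<in> E} \<le> ennreal c" for f
  proof (cases "\<exists>y. f(x := y) \<in> E")
    case True
    then obtain y where "f(x := y) \<in> E" by blast
    then have "{y. f(x := y) \<in> E} = {y}" using E by auto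
    then show ?thesis using c by (simp add: emeasure_pmf_single ennreal_leI)
  qed simp
  then have "emeasure (Pi_pmf A d p) E \<le> (\<integral>\<^sup>+f. ennreal c \<partial>?F)"
    unfolding eq emeasure_bind_pmf by (intro nn_integral_mono) (simp add: vimage_def)
  then show ?thesis using c by (simp add: measure_pmf.emeasure_eq_measure)
qed

text \<open>
  The determinant is affine in its last diagonal entry because the cofactors of the last row do not
  involve that row.
\<close>
lemma det_leading_update:
  fixes f :: "nat \<times> nat \<Rightarrow> 'a :: comm_ring_1"
  shows "det (mat (Suc t) (Suc t) (f((t, t) := y))) - det (mat (Suc t) (Suc t) (f((t, t) := z))) =
    (y - z) * det (mat t t f)"
proof -
  let ?A = "\<lambda>y. mat (Suc t) (Suc t) (f((t, t) := y))"
  have del: "mat_delete (?A y) t j = mat_delete (?A 0) t j" for y j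
    by (intro eq_matI) (auto simp: mat_delete_def)
  have "mat_delete (?A 0) t t = mat t t f"
    by (intro eq_matI) (auto simp: mat_delete_def)
  then have cof: "cofactor (?A 0) t t = det (mat t t f)"
    by (simp add: cofactor_def)
  have "det (?A y) = (\<Sum>j<t. f (t, j) * cofactor (?A 0) t j) + y * det (mat t t f)" for y
  proof -
    have "det (?A y) = (\<Sum>j<Suc t. ?A y $$ (t, j) * cofactor (?A 0) t j)"
      by (subst laplace_expansion_row[of _ "Suc t" t]) (auto simp: cofactor_def del[of y])
    then show ?thesis by (simp add: cof)
  qed
  then show ?thesis by (simp add: algebra_simps)
qed

lemma prob_leading_minor_zero:
  assumes "t \<le> m" "m \<le> n"
  shows "measure_pmf.prob (Pi_pmf ({..<n} \<times> {..<m}) 0 (\<lambda>_. pmf_of_set {- int k..int k}))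
           {f. det (mat t t f) = 0} \<le> real t / real (2 * k + 1)"
  using assms(1)
proof (induction t)
  case 0
  then show ?case by (simp add: det_dim_zero)
next
  case (Suc t)
  let ?p = "Pi_pmf ({..<n} \<times> {..<m}) 0 (\<lambda>_. pmf_of_set {- int k..int k})"
  let ?Z = "\<lambda>t. {f. det (mat t t f) = (0 :: int)}"
  \<comment> \<open>While the smaller minor is nonzero, a vanishing larger minor determines the entry \<open>(t, t)\<close>.\<close>
  have "measure_pmf.prob ?p (?Z (Suc t) - ?Z t) \<le> 1 / real (2 * k + 1)"
  proof (rule prob_Pi_pmf_one_coordinate)
    show "(t, t) \<in> {..<n} \<times> {..<m}" using Suc.prems assms(2) by simp
    show "pmf (pmf_of_set {- int k..int k}) y \<le> 1 / real (2 * k + 1)" for y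
      by (auto simp: indicator_def nat_add_distrib divide_simps)
  next
    fix f y z
    assume y: "f((t, t) := y) \<in> ?Z (Suc t) - ?Z t" and z: "f((t, t) := z) \<in> ?Z (Suc t) - ?Z t"
    have "mat t t (f((t, t) := y)) = mat t t f" by (intro eq_matI) auto
    then show "y = z" using y z det_leading_update[of t f y z] by auto
  qed auto
  moreover have "measure_pmf.prob ?p (?Z t) \<le> real t / real (2 * k + 1)" using Suc by simp
  moreover have "measure_pmf.prob ?p (?Z (Suc t)) \<le>
      measure_pmf.prob ?p (?Z t) + measure_pmf.prob ?p (?Z (Suc t) - ?Z t)"
  proof -
    have "measure_pmf.prob ?p (?Z (Suc t)) \<le> measure_pmf.prob ?p (?Z t \<union> (?Z (Suc t) - ?Z t))"
      by (rule measure_pmf.finite_measure_mono) auto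
    also have "\<dots> \<le> measure_pmf.prob ?p (?Z t) + measure_pmf.prob ?p (?Z (Suc t) - ?Z t)"
      by (rule measure_Un_le) auto
    finally show ?thesis .
  qed
  ultimately show ?case by (simp add: add_divide_distrib)
qed

theorem theorem4p6:
  fixes m n :: nat
  assumes "0 < m" and "m \<le> n"
  shows "(\<forall>S. S \<subseteq> SNF_set n m \<and> (\<forall>D\<in>S. D $$ (m - 1, m - 1) = 0) \<longrightarrow>
            convergent (\<lambda>k. mu_k k n m S) \<and> mu n m S = 0) \<and>
         (\<lambda>k. measure_pmf.prob (random_int_mat k n m)
                {M. vec_space.rank n (map_mat rat_of_int M) = m}) \<longlonglongrightarrow> 1"
proof -
  let ?p = "\<lambda>k. Pi_pmf ({..<n} \<times> {..<m}) 0 (\<lambda>_. pmf_of_set {- int k..int k})"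
  let ?Z = "{f. det (mat m m f) = (0 :: int)}"
  have bound: "measure_pmf.prob (random_int_mat k n m) E \<le> real m / real (2 * k + 1)"
    if "\<And>f. mat n m f \<in> E \<Longrightarrow> det (mat m m f) = 0" for k E
  proof -
    have "measure_pmf.prob (random_int_mat k n m) E = measure_pmf.prob (?p k) (mat n m -` E)"
      by (simp add: random_int_mat_def)
    also have "\<dots> \<le> measure_pmf.prob (?p k) ?Z"
      by (rule measure_pmf.finite_measure_mono) (use that in auto)
    also have "\<dots> \<le> real m / real (2 * k + 1)"
      by (rule prob_leading_minor_zero) (use assms in auto)
    finally show ?thesis .
  qed
  have lim: "(\<lambda>k. real m / real (2 * k + 1)) \<longlonglongrightarrow> 0"
    using LIMSEQ_subseq_LIMSEQ[OF lim_const_over_n[of "real m"], of "\<lambda>k. 2 * k + 1"]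
    by (simp add: strict_mono_def comp_def)
  have small: "(\<lambda>k. measure_pmf.prob (random_int_mat k n m) E) \<longlonglongrightarrow> 0"
    if "\<And>f. mat n m f \<in> E \<Longrightarrow> det (mat m m f) = 0" for E
    by (rule tendsto_sandwich[OF _ _ tendsto_const lim]) (use bound that in auto)
  show ?thesis
  proof (intro conjI allI impI)
    fix S assume S: "S \<subseteq> SNF_set n m \<and> (\<forall>D\<in>S. D $$ (m - 1, m - 1) = 0)"
    have "(\<lambda>k. mu_k k n m S) \<longlonglongrightarrow> 0"
      unfolding mu_k_def using SNF_last_diag_nonzero[OF assms] S by (intro small) blast
    then show "convergent (\<lambda>k. mu_k k n m S)" "mu n m S = 0"
      by (auto simp: convergent_def mu_def intro: limI)
  next
    let ?E = "{M. vec_space.rank n (map_mat rat_of_int M) = m}"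
    have "(\<lambda>k. 1 - measure_pmf.prob (random_int_mat k n m) (- ?E)) \<longlonglongrightarrow> 1 - 0"
      using rank_of_leading_minor[OF assms(2)] by (intro tendsto_intros small) blast
    then show "(\<lambda>k. measure_pmf.prob (random_int_mat k n m) ?E) \<longlonglongrightarrow> 1"
      using measure_pmf.prob_compl[of ?E] by (simp add: Compl_eq_Diff_UNIV)
  qed
qed

end
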